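(* Let $I\subseteq\mathbb{R}$ be an interval, let $g:I\to\mathbb{R}$ be a nonnegative function belonging to the class $P(I)$, and let $f:I\to\mathbb{R}$ be a real function that is $(g,P(I))$-convex dominated on $I$. If $a,b\in I$ with $a<b$ and $f,g\in L_1[a,b]$, then $$\left|\frac{2}{b-a}\int_a^b f(x)\,dx-f\left(\frac{a+b}{2}\right)\right|\le \frac{2}{b-a}\int_a^b g(x)\,dx-g\left(\frac{a+b}{2}\right)$$ and $$\left|[f(a)+f(b)]-\frac{1}{b-a}\int_a^b f(x)\,dx\right|\le [g(a)+g(b)]-\frac{1}{b-a}\int_a^b g(x)\,dx.$$
   Context: A function $g:I\to\mathbb{R}$ belongs to the class $P(I)$ if it is nonnegative and for all $x,y\in I$ and $\lambda\in[0,1]$ it satisfies $g(\lambda x+(1-\lambda)y)\le g(x)+g(y)$. Given a nonnegative $g\in P(I)$, a function $f:I\to\mathbb{R}$ is called $(g,P(I))$-convex dominated on $I$ if for all $x,y\in I$ and $\lambda\in[0,1]$, $$\left|[f(x)+f(y)]-f(\lambda x+(1-\lambda)y)\right|\le [g(x)+g(y)]-g(\lambda x+(1-\lambda)y).$$ $L_1[a,b]$ denotes the Lebesgue integrable functions on $[a,b]$. *)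

theory Defs
  imports "HOL-Analysis.Analysis"
begin

text \<open>A function on \<open>I\<close> is modelled by a total function on the reals whose values outside \<open>I\<close>
  are irrelevant: every condition below only evaluates it at points of \<open>I\<close> when \<open>I\<close> is an interval.\<close>

definition class_P :: "real set \<Rightarrow> (real \<Rightarrow> real) set" where
  "class_P I = {g. (\<forall>x\<in>I. 0 \<le> g x) \<and>
     (\<forall>x\<in>I. \<forall>y\<in>I. \<forall>t\<in>{0..1}. g (t * x + (1 - t) * y) \<le> g x + g y)}"

definition P_convex_dominated :: "real set \<Rightarrow> (real \<Rightarrow> real) \<Rightarrow> (real \<Rightarrow> real) \<Rightarrow> bool" where
  "P_convex_dominated I g f \<longleftrightarrow>
     (\<forall>x\<in>I. \<forall>y\<in>I. \<forall>t\<in>{0..1}.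
        \<bar>(f x + f y) - f (t * x + (1 - t) * y)\<bar> \<le> (g x + g y) - g (t * x + (1 - t) * y))"

end

theory Submission
  imports Defs
begin

text \<open>
  The domination inequality has the form \<open>\<bar>L f\<bar> \<le> L g\<close>, where \<open>L h = h x + h y - h (t x + (1 - t) y)\<close>
  is linear in \<open>h\<close>, so it says exactly that \<open>L (g + f)\<close> and \<open>L (g - f)\<close> are nonnegative. Hence \<open>h = g + f\<close> and \<open>h = g - f\<close>
  satisfy \<open>h (t x + (1 - t) y) \<le> h x + h y\<close>, and by the same linearity each of the two conclusions says that a
  Hermite--Hadamard inequality \<open>h ((a + b) / 2) \<le> 2 / (b - a) \<integral> h\<close> or
  \<open>1 / (b - a) \<integral> h \<le> h a + h b\<close> holds for these two functions.

  The upper bound follows by integrating \<open>h x \<le> h a + h b\<close> (\<open>integral_le_endpoints\<close>). For the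
  lower bound, the midpoint of \<open>[a, b]\<close> is also the midpoint of \<open>x\<close> and its mirror image
  \<open>a + b - x\<close>, so \<open>h ((a + b) / 2) \<le> h x + h (a + b - x)\<close>, and the two terms on the right have the
  same integral (\<open>midpoint_le_integral\<close>).
\<close>

lemma has_integral_reflect_midpoint:
  fixes h :: "real \<Rightarrow> real"
  assumes "(h has_integral i) {a..b}"
  shows "((\<lambda>x. h (a + b - x)) has_integral i) {a..b}"
proof -
  have "((\<lambda>x. h ((- 1) *\<^sub>R x + (a + b))) has_integral (1 / \<bar>- 1\<bar> ^ DIM(real)) *\<^sub>R i)
          ((\<lambda>x. (1 / - 1) *\<^sub>R x + - ((1 / - 1) *\<^sub>R (a + b))) ` cbox a b)"
    by (rule has_integral_affinity) (use assms in simp_all)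
  moreover have "(\<lambda>x. (1 / - 1) *\<^sub>R x + - ((1 / - 1) *\<^sub>R (a + b))) ` cbox a b = {a..b}"
    by (force intro!: image_eqI[where x = "a + b - _"])
  ultimately show ?thesis
    by (simp add: algebra_simps)
qed

lemma midpoint_le_integral:
  fixes h :: "real \<Rightarrow> real"
  assumes "a < b" and "h integrable_on {a..b}"
    and mid: "\<And>x y. x \<in> {a..b} \<Longrightarrow> y \<in> {a..b} \<Longrightarrow> h ((x + y) / 2) \<le> h x + h y"
  shows "h ((a + b) / 2) \<le> 2 / (b - a) * integral {a..b} h"
proof -
  have h: "(h has_integral integral {a..b} h) {a..b}"
    using assms(2) by (rule integrable_integral)
  have const: "((\<lambda>x. h ((a + b) / 2)) has_integral (b - a) * h ((a + b) / 2)) {a..b}"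
    using has_integral_const_real[of "h ((a + b) / 2)" a b] \<open>a < b\<close> by simp
  have "h ((a + b) / 2) \<le> h x + h (a + b - x)" if "x \<in> {a..b}" for x
    using mid[of x "a + b - x"] that by simp
  then have "(b - a) * h ((a + b) / 2) \<le> integral {a..b} h + integral {a..b} h"
    by (rule has_integral_le[OF const has_integral_add[OF h has_integral_reflect_midpoint[OF h]]])
  with \<open>a < b\<close> show ?thesis
    by (simp add: field_simps)
qed

lemma integral_le_endpoints:
  fixes h :: "real \<Rightarrow> real"
  assumes "a < b" and "h integrable_on {a..b}"
    and le: "\<And>x. x \<in> {a..b} \<Longrightarrow> h x \<le> h a + h b"
  shows "1 / (b - a) * integral {a..b} h \<le> h a + h b"
proof -
  have h: "(h has_integral integral {a..b} h) {a..b}"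
    using assms(2) by (rule integrable_integral)
  have const: "((\<lambda>x. h a + h b) has_integral (b - a) * (h a + h b)) {a..b}"
    using has_integral_const_real[of "h a + h b" a b] \<open>a < b\<close> by simp
  have "integral {a..b} h \<le> (b - a) * (h a + h b)"
    using le by (rule has_integral_le[OF h const])
  with \<open>a < b\<close> show ?thesis
    by (simp add: field_simps)
qed

text \<open>
  Weight \<open>t = 1 / 2\<close> gives the midpoint bound; writing \<open>x\<close> as a convex combination of \<open>a\<close> and \<open>b\<close>
  gives the endpoint bound. Integrability is in the Henstock--Kurzweil sense, where sums and
  differences of functions and reflection of the interval are available directly.
\<close>

lemma Hermite_Hadamard_class_P:
  fixes h :: "real \<Rightarrow> real"
  assumes "a < b" and "h integrable_on {a..b}"
    and P: "\<And>x y t. x \<in> {a..b} \<Longrightarrow> y \<in> {a..b} \<Longrightarrow> t \<in> {0..1} \<Longrightarrow>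
              h (t * x + (1 - t) * y) \<le> h x + h y"
  shows "h ((a + b) / 2) \<le> 2 / (b - a) * integral {a..b} h"
    and "1 / (b - a) * integral {a..b} h \<le> h a + h b"
proof -
  have "h ((x + y) / 2) \<le> h x + h y" if "x \<in> {a..b}" "y \<in> {a..b}" for x y
    using P[OF that, of "1 / 2"] by (simp add: add_divide_distrib)
  then show "h ((a + b) / 2) \<le> 2 / (b - a) * integral {a..b} h"
    by (rule midpoint_le_integral[OF assms(1,2)])
  have "h x \<le> h a + h b" if "x \<in> {a..b}" for x
  proof -
    let ?t = "(b - x) / (b - a)"
    have "?t \<in> {0..1}"
      using that \<open>a < b\<close> by simp
    moreover have "?t * a + (1 - ?t) * b = x"
      using \<open>a < b\<close> by (simp add: divide_simps) (simp add: algebra_simps)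
    ultimately show ?thesis
      using P[of a b ?t] \<open>a < b\<close> by simp
  qed
  then show "1 / (b - a) * integral {a..b} h \<le> h a + h b"
    by (rule integral_le_endpoints[OF assms(1,2)])
qed

theorem theorem4:
  fixes I :: "real set" and f g :: "real \<Rightarrow> real" and a b :: real
  assumes "is_interval I"
    and "g \<in> class_P I"
    and "P_convex_dominated I g f"
    and "a \<in> I" and "b \<in> I" and "a < b"
    and "set_integrable lebesgue {a..b} f"
    and "set_integrable lebesgue {a..b} g"
  shows "\<bar>2 / (b - a) * (LINT x:{a..b}|lebesgue. f x) - f ((a + b) / 2)\<bar>
           \<le> 2 / (b - a) * (LINT x:{a..b}|lebesgue. g x) - g ((a + b) / 2)
       \<and> \<bar>(f a + f b) - 1 / (b - a) * (LINT x:{a..b}|lebesgue. f x)\<bar>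
           \<le> (g a + g b) - 1 / (b - a) * (LINT x:{a..b}|lebesgue. g x)"
proof -
  have int: "f integrable_on {a..b}" "g integrable_on {a..b}"
    using assms(7,8) by (auto intro: set_lebesgue_integral_eq_integral(1))
  have LINT: "(LINT x:{a..b}|lebesgue. f x) = integral {a..b} f"
      "(LINT x:{a..b}|lebesgue. g x) = integral {a..b} g"
    using assms(7,8) by (auto intro: set_lebesgue_integral_eq_integral(2))
  have sub: "x \<in> I" if "x \<in> {a..b}" for x
    using assms(1,4,5) that unfolding is_interval_1 by (meson atLeastAtMost_iff)
  have dom: "\<bar>(f x + f y) - f (t * x + (1 - t) * y)\<bar> \<le> (g x + g y) - g (t * x + (1 - t) * y)"
    if "x \<in> {a..b}" "y \<in> {a..b}" "t \<in> {0..1}" for x y t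
    using assms(3) sub that unfolding P_convex_dominated_def by blast
  have plus: "g (t * x + (1 - t) * y) + f (t * x + (1 - t) * y) \<le> (g x + f x) + (g y + f y)"
    if "x \<in> {a..b}" "y \<in> {a..b}" "t \<in> {0..1}" for x y t
    using dom[OF that] by linarith
  have minus: "g (t * x + (1 - t) * y) - f (t * x + (1 - t) * y) \<le> (g x - f x) + (g y - f y)"
    if "x \<in> {a..b}" "y \<in> {a..b}" "t \<in> {0..1}" for x y t
    using dom[OF that] by linarith
  note HH_plus = Hermite_Hadamard_class_P[OF \<open>a < b\<close> integrable_add[OF int(2,1)] plus]
  note HH_minus = Hermite_Hadamard_class_P[OF \<open>a < b\<close> integrable_diff[OF int(2,1)] minus]
  show ?thesis
    using HH_plus HH_minus
    unfolding LINT integral_add[OF int(2,1)] integral_diff[OF int(2,1)] distrib_left right_diff_distrib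
    by linarith
qed

end
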